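(* Let $\Omega=\{x\in M_2(\mathbb C): \rho(x)<1\}$ be the spectral ball of $2\times 2$ complex matrices, where $\rho$ denotes the spectral radius. Let $\varphi:\mathbb C\to\mathbb C$ be an entire holomorphic function and define, for $x=(x_{ij})\in\Omega$, $$f(x)=\begin{pmatrix} x_{11} & e^{-\varphi(x_{12}x_{21})}x_{12} \\ e^{\varphi(x_{12}x_{21})}x_{21} & x_{22}\end{pmatrix}.$$ Then $f$ is an automorphism of $\Omega$. Moreover, if $\varphi$ is non-constant, then $f$ is not generated by the automorphisms of $\Omega$ of the forms (i) transpositions, (ii) Möbius maps, (iii) conjugations by conjugation-invariant holomorphic maps; that is, $f$ does not belong to the subgroup of $\operatorname{Aut}(\Omega)$ generated by all the maps of these three forms: (i) $\mathcal T:x\mapsto x^t$; (ii) $\mathcal M_{\alpha,\gamma}:x\mapsto \gamma(x-\alpha I)(I-\overline{\alpha}x)^{-1}$, where $\alpha,\gamma\in\mathbb C$, $|\alpha|<1$, $|\gamma|=1$; (iii) $\mathcal J_u:x\mapsto u(x)^{-1}\,x\,u(x)$, where $u:\Omega\to GL_2(\mathbb C)$ is holomorphic and satisfies $u(q^{-1}xq)=u(x)$ for all $x\in\Omega$ and all $q\in GL_2(\mathbb C)$.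
   Context: $M_2(\mathbb C)$ is the space of $2\times2$ complex matrices, identified with $\mathbb C^4$; $\Omega$ is an open subset of it. An automorphism of $\Omega$ is a biholomorphic map of $\Omega$ onto itself, and $\operatorname{Aut}(\Omega)$ is the group of automorphisms under composition. $GL_2(\mathbb C)$ is the group of invertible $2\times 2$ complex matrices, $I$ is the identity matrix, and $x^t$ is the transpose of $x$. Each of the maps of the forms (i), (ii), (iii) is an automorphism of $\Omega$. *)

theory Defs
  imports "HOL-Analysis.Analysis" "HOL-Algebra.Bij" "HOL-Algebra.Generated_Groups"
begin

unbundle no fps_syntax

type_synonym cmat2 = "complex ^ 2 ^ 2"

text \<open>The operation \<open>*s\<close> of the library scales vectors by an element of their component type,
  so on matrices it is not multiplication by a complex number.\<close>

definition cscale :: "complex \<Rightarrow> complex ^ 'n ^ 'm \<Rightarrow> complex ^ 'n ^ 'm"  (infixr \<open>*\<^sub>C\<close> 75)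
  where "c *\<^sub>C A = (\<chi> i j. c * A $ i $ j)"

text \<open>Holomorphy in several variables as complex Frechet differentiability; as for
  \<open>holomorphic_on\<close>, the intended domains are open sets.\<close>

definition matrix_holomorphic_on :: "(complex ^ 'n ^ 'm \<Rightarrow> complex ^ 'p ^ 'q) \<Rightarrow> (complex ^ 'n ^ 'm) set \<Rightarrow> bool"
  where "matrix_holomorphic_on f S \<longleftrightarrow>
    (\<forall>x\<in>S. \<exists>D. (f has_derivative D) (at x within S) \<and> (\<forall>c h. D (c *\<^sub>C h) = c *\<^sub>C D h))"

definition matrix_spectrum :: "complex ^ 'n ^ 'n \<Rightarrow> complex set"
  where "matrix_spectrum A = {k. \<exists>v. v \<noteq> 0 \<and> A *v v = k *s v}"

definition matrix_spectral_radius :: "complex ^ 'n ^ 'n \<Rightarrow> real"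
  where "matrix_spectral_radius A = Max (norm ` matrix_spectrum A)"

definition spectral_ball :: "cmat2 set"
  where "spectral_ball = {x. matrix_spectral_radius x < 1}"

text \<open>As in \<open>BijGroup\<close>, self-maps of a set are represented by extensional functions.\<close>

definition biholo :: "(complex ^ 'n ^ 'm) set \<Rightarrow> (complex ^ 'n ^ 'm \<Rightarrow> complex ^ 'n ^ 'm) set"
  where "biholo S = {f \<in> Bij S. matrix_holomorphic_on f S \<and> matrix_holomorphic_on (inv_into S f) S}"

definition Aut :: "(complex ^ 'n ^ 'm) set \<Rightarrow> (complex ^ 'n ^ 'm \<Rightarrow> complex ^ 'n ^ 'm) monoid"
  where "Aut S = BijGroup S \<lparr>carrier := biholo S\<rparr>"

lemma matrix_holomorphic_on_cong:
  assumes "\<And>x. x \<in> S \<Longrightarrow> f x = g x"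
  shows "matrix_holomorphic_on f S \<longleftrightarrow> matrix_holomorphic_on g S"
  unfolding matrix_holomorphic_on_def
proof (intro ball_cong refl ex_cong1 conj_cong)
  fix x D assume "x \<in> S"
  then show "(f has_derivative D) (at x within S) \<longleftrightarrow> (g has_derivative D) (at x within S)"
    using has_derivative_transform[of x S f g D] has_derivative_transform[of x S g f D] assms by auto
qed

lemma matrix_holomorphic_on_id: "matrix_holomorphic_on (\<lambda>x. x) S"
  unfolding matrix_holomorphic_on_def by (intro ballI exI[of _ "\<lambda>x. x"]) auto

lemma matrix_holomorphic_on_compose:
  assumes f: "matrix_holomorphic_on f S" and g: "matrix_holomorphic_on g T" and "f ` S \<subseteq> T"
  shows "matrix_holomorphic_on (\<lambda>x. g (f x)) S"
  unfolding matrix_holomorphic_on_def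
proof
  fix x assume x: "x \<in> S"
  obtain D where D: "(f has_derivative D) (at x within S)" "\<And>c h. D (c *\<^sub>C h) = c *\<^sub>C D h"
    using f x unfolding matrix_holomorphic_on_def by blast
  obtain E where E: "(g has_derivative E) (at (f x) within T)" "\<And>c h. E (c *\<^sub>C h) = c *\<^sub>C E h"
    using g x \<open>f ` S \<subseteq> T\<close> unfolding matrix_holomorphic_on_def by blast
  have "((\<lambda>x. g (f x)) has_derivative (\<lambda>h. E (D h))) (at x within S)"
    using has_derivative_in_compose[OF D(1) has_derivative_subset[OF E(1) \<open>f ` S \<subseteq> T\<close>]] .
  then show "\<exists>D. ((\<lambda>x. g (f x)) has_derivative D) (at x within S) \<and> (\<forall>c h. D (c *\<^sub>C h) = c *\<^sub>C D h)"
    using D(2) E(2) by auto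
qed

lemma subgroup_biholo: "subgroup (biholo S) (BijGroup S)"
proof (rule subgroup.intro)
  show "biholo S \<subseteq> carrier (BijGroup S)"
    by (auto simp: biholo_def BijGroup_def)
next
  fix f g assume fg: "f \<in> biholo S" "g \<in> biholo S"
  then have B: "f \<in> Bij S" "g \<in> Bij S" by (auto simp: biholo_def)
  then have bij: "bij_betw f S S" "bij_betw g S S" by (auto simp: Bij_def)
  have holo: "matrix_holomorphic_on (compose S f g) S"
    using fg bij matrix_holomorphic_on_compose[of g S f S]
    by (subst matrix_holomorphic_on_cong[where g = "\<lambda>x. f (g x)"])
      (auto simp: biholo_def compose_def bij_betw_def)
  have inv_eq: "inv_into S (compose S f g) y = inv_into S g (inv_into S f y)" if "y \<in> S" for y
  proof (rule inv_into_f_eq)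
    show "inj_on (compose S f g) S"
      using compose_Bij[OF B] by (simp add: Bij_def bij_betw_def)
    show mem: "inv_into S g (inv_into S f y) \<in> S"
      by (intro Bij_inv_into_mem B that)
    show "compose S f g (inv_into S g (inv_into S f y)) = y"
      using mem bij that Bij_inv_into_mem[OF B(1) that]
      by (simp add: compose_def bij_betw_inv_into_right)
  qed
  have "matrix_holomorphic_on (\<lambda>y. inv_into S g (inv_into S f y)) S"
    using fg Bij_inv_into_mem[OF B(1)]
    by (intro matrix_holomorphic_on_compose[of "inv_into S f" S "inv_into S g" S]) (auto simp: biholo_def)
  then have "matrix_holomorphic_on (inv_into S (compose S f g)) S"
    by (subst matrix_holomorphic_on_cong[OF inv_eq])
  then show "f \<otimes>\<^bsub>BijGroup S\<^esub> g \<in> biholo S"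
    using holo B by (simp add: biholo_def BijGroup_def compose_Bij)
next
  have "inv_into S (\<lambda>x\<in>S. x) y = y" if "y \<in> S" for y
    by (rule inv_into_f_eq) (use that in \<open>auto simp: inj_on_def\<close>)
  then have "matrix_holomorphic_on (inv_into S (\<lambda>x\<in>S. x)) S"
    using matrix_holomorphic_on_cong[of S "inv_into S (\<lambda>x\<in>S. x)" "\<lambda>x. x"] matrix_holomorphic_on_id by blast
  moreover have "matrix_holomorphic_on (\<lambda>x\<in>S. x) S"
    using matrix_holomorphic_on_cong[of S "\<lambda>x\<in>S. x" "\<lambda>x. x"] matrix_holomorphic_on_id by auto
  ultimately show "\<one>\<^bsub>BijGroup S\<^esub> \<in> biholo S"
    by (simp add: biholo_def BijGroup_def id_Bij)
next
  fix f assume f: "f \<in> biholo S"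
  then have B: "f \<in> Bij S" by (simp add: biholo_def)
  then have bij: "bij_betw f S S" by (simp add: Bij_def)
  let ?g = "\<lambda>x\<in>S. inv_into S f x"
  have gB: "?g \<in> Bij S" by (rule restrict_inv_into_Bij[OF B])
  have "matrix_holomorphic_on ?g S"
    using f matrix_holomorphic_on_cong[of S ?g "inv_into S f"] by (auto simp: biholo_def)
  moreover have "inv_into S ?g y = f y" if "y \<in> S" for y
  proof (rule inv_into_f_eq)
    show "inj_on ?g S" using gB by (simp add: Bij_def bij_betw_def)
    show "f y \<in> S" using bij that by (auto simp: bij_betw_def)
    then show "?g (f y) = y" using bij that by (simp add: bij_betw_inv_into_left)
  qed
  then have "matrix_holomorphic_on (inv_into S ?g) S"
    using f matrix_holomorphic_on_cong[of S "inv_into S ?g" f] by (auto simp: biholo_def)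
  ultimately show "inv\<^bsub>BijGroup S\<^esub> f \<in> biholo S"
    using gB by (simp add: inv_BijGroup[OF B] biholo_def)
qed

theorem group_Aut: "group (Aut S)"
  by (simp add: Aut_def subgroup.subgroup_is_group subgroup_biholo group_BijGroup)

definition moebius :: "complex \<Rightarrow> complex \<Rightarrow> cmat2 \<Rightarrow> cmat2"
  where "moebius \<alpha> \<gamma> x = \<gamma> *\<^sub>C ((x - \<alpha> *\<^sub>C mat 1) ** matrix_inv (mat 1 - cnj \<alpha> *\<^sub>C x))"

definition conjugation :: "(cmat2 \<Rightarrow> cmat2) \<Rightarrow> cmat2 \<Rightarrow> cmat2"
  where "conjugation u x = matrix_inv (u x) ** x ** u x"

definition conj_invariant_holomorphic :: "(cmat2 \<Rightarrow> cmat2) \<Rightarrow> bool"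
  where "conj_invariant_holomorphic u \<longleftrightarrow>
    matrix_holomorphic_on u spectral_ball \<and>
    (\<forall>x\<in>spectral_ball. invertible (u x)) \<and>
    (\<forall>x\<in>spectral_ball. \<forall>q. invertible q \<longrightarrow> u (matrix_inv q ** x ** q) = u x)"

definition standard_automorphisms :: "(cmat2 \<Rightarrow> cmat2) set"
  where "standard_automorphisms =
    {restrict transpose spectral_ball} \<union>
    {restrict (moebius \<alpha> \<gamma>) spectral_ball | \<alpha> \<gamma>. norm \<alpha> < 1 \<and> norm \<gamma> = 1} \<union>
    {restrict (conjugation u) spectral_ball | u. conj_invariant_holomorphic u}"

definition twist :: "(complex \<Rightarrow> complex) \<Rightarrow> cmat2 \<Rightarrow> cmat2"
  where "twist \<phi> x = vector
    [vector [x $ 1 $ 1, exp (- \<phi> (x $ 1 $ 2 * x $ 2 $ 1)) * x $ 1 $ 2],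
     vector [exp (\<phi> (x $ 1 $ 2 * x $ 2 $ 1)) * x $ 2 $ 1, x $ 2 $ 2]]"

end

theory Submission
  imports Defs
begin

text \<open>On a single similarity class, a transposition is linear, a conjugation by an invariant \<open>u\<close> is
  conjugation by a fixed matrix, and a Moebius map is affine by Cayley--Hamilton. These maps
  send similarity classes into similarity classes, so every element of the generated group is
  affine on each class. The \<open>(1,2)\<close> entry of a twist is \<open>exp (- \<phi> (x\<^sub>1\<^sub>2 x\<^sub>2\<^sub>1)) x\<^sub>1\<^sub>2\<close>;
  on the class with eigenvalues \<open>\<plusminus> 1/2\<close> the product \<open>x\<^sub>1\<^sub>2 x\<^sub>2\<^sub>1\<close> takes every complex value,
  and being affine there forces \<open>exp (- \<phi>)\<close> to be constant.\<close>

section \<open>Entrywise algebra and inverses of matrices\<close>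

lemma mat2_eq_iff:
  "(A :: 'a ^ 2 ^ 2) = B \<longleftrightarrow> A$1$1 = B$1$1 \<and> A$1$2 = B$1$2 \<and> A$2$1 = B$2$1 \<and> A$2$2 = B$2$2"
  by (auto simp: vec_eq_iff forall_2)

lemma matrix_mult_2:
  fixes A B :: "'a::semiring_1 ^ 2 ^ 2"
  shows "(A ** B) $ i $ j = A$i$1 * B$1$j + A$i$2 * B$2$j"
  by (simp add: matrix_matrix_mult_def sum_2)

lemma trace_2: "trace (A :: 'a::semiring_1 ^ 2 ^ 2) = A$1$1 + A$2$2"
  by (simp add: trace_def sum_2)

lemma mat_2_nth [simp]:
  "(mat c :: 'a::zero ^ 2 ^ 2)$1$1 = c" "(mat c :: 'a ^ 2 ^ 2)$2$2 = c"
  "(mat c :: 'a ^ 2 ^ 2)$1$2 = 0" "(mat c :: 'a ^ 2 ^ 2)$2$1 = 0"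
  by (simp_all add: mat_def)

lemma matrix_add_rdistrib: "(A + B) ** C = A ** C + B ** C"
  by (simp add: vec_eq_iff matrix_matrix_mult_def sum.distrib distrib_right)

lemma cscale_nth [simp]: "(c *\<^sub>C A) $ i $ j = c * A $ i $ j"
  by (simp add: cscale_def)

lemma cscale_mult_left: "(c *\<^sub>C A) ** B = c *\<^sub>C (A ** B)"
  by (simp add: vec_eq_iff matrix_matrix_mult_def sum_distrib_left mult.assoc)

lemma cscale_mult_right: "A ** (c *\<^sub>C B) = c *\<^sub>C (A ** B)"
  by (simp add: vec_eq_iff matrix_matrix_mult_def sum_distrib_left algebra_simps)

text \<open>\<open>matrix_inv\<close> is a choice of two-sided inverse. A right inverse of a square
  matrix over a field is two-sided, so the choice is forced. Every explicit inverse below is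
  identified this way.\<close>

lemma matrix_inv_unique:
  fixes A B :: "'a::field ^ 'n ^ 'n"
  assumes "A ** B = mat 1"
  shows "matrix_inv A = B"
proof -
  have BA: "B ** A = mat 1" using assms by (simp add: matrix_left_right_inverse)
  have "\<exists>X. A ** X = mat 1 \<and> X ** A = mat 1" using assms BA by blast
  then have "matrix_inv A ** A = mat 1"
    unfolding matrix_inv_def by (metis (mono_tags, lifting) someI_ex)
  then show ?thesis
    by (metis assms matrix_mul_assoc matrix_mul_lid matrix_mul_rid)
qed

lemma invertible_matrix_inv:
  fixes A :: "'a::field ^ 'n ^ 'n"
  assumes "invertible A"
  shows "A ** matrix_inv A = mat 1" "matrix_inv A ** A = mat 1"
    "invertible (matrix_inv A)" "matrix_inv (matrix_inv A) = A"
proof -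
  obtain B where B: "A ** B = mat 1" using assms by (auto simp: invertible_def)
  then show "A ** matrix_inv A = mat 1" by (simp add: matrix_inv_unique)
  then show *: "matrix_inv A ** A = mat 1" by (simp add: matrix_left_right_inverse)
  then show "invertible (matrix_inv A)" using invertible_right_inverse by blast
  show "matrix_inv (matrix_inv A) = A" using * by (rule matrix_inv_unique)
qed

lemma matrix_inv_mult:
  fixes A B :: "'a::field ^ 'n ^ 'n"
  assumes "invertible A" "invertible B"
  shows "matrix_inv (A ** B) = matrix_inv B ** matrix_inv A"
proof (rule matrix_inv_unique)
  have "A ** B ** (matrix_inv B ** matrix_inv A) = A ** (B ** matrix_inv B) ** matrix_inv A"
    by (simp add: matrix_mul_assoc)
  then show "A ** B ** (matrix_inv B ** matrix_inv A) = mat 1"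
    using assms by (simp add: invertible_matrix_inv)
qed

lemma matrix_inv_2:
  fixes A :: "'a::field ^ 2 ^ 2"
  assumes "det A \<noteq> 0"
  shows "matrix_inv A = vector [vector [A$2$2 / det A, - A$1$2 / det A],
                                vector [- A$2$1 / det A, A$1$1 / det A]]"
proof (rule matrix_inv_unique)
  have "A$1$1 * A$2$2 / det A - A$1$2 * A$2$1 / det A = 1"
    using assms by (simp add: det_2 flip: diff_divide_distrib)
  then show "A ** vector [vector [A$2$2 / det A, - A$1$2 / det A],
                          vector [- A$2$1 / det A, A$1$1 / det A]] = mat 1"
    by (simp add: mat2_eq_iff matrix_mult_2 mult.commute)
qed

section \<open>Holomorphic functions of a matrix\<close>

text \<open>Counterpart of \<open>matrix_holomorphic_on\<close> for a single entry, so that closure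
  rules can be stated for sums, products and quotients of entries.\<close>

definition scalar_holomorphic_on :: "(complex ^ 'n ^ 'm \<Rightarrow> complex) \<Rightarrow> (complex ^ 'n ^ 'm) set \<Rightarrow> bool"
  where "scalar_holomorphic_on f S \<longleftrightarrow>
    (\<forall>x\<in>S. \<exists>D. (f has_derivative D) (at x within S) \<and> (\<forall>c h. D (c *\<^sub>C h) = c * D h))"

lemma scalar_holomorphic_on_const: "scalar_holomorphic_on (\<lambda>x. c) S"
  unfolding scalar_holomorphic_on_def by (intro ballI exI[of _ "\<lambda>x. 0"]) auto

lemma scalar_holomorphic_on_nth: "scalar_holomorphic_on (\<lambda>x. x $ i $ j) S"
  unfolding scalar_holomorphic_on_def
  by (intro ballI exI[of _ "\<lambda>x. x $ i $ j"])
    (auto intro!: bounded_linear_imp_has_derivative bounded_linear_compose[OF bounded_linear_vec_nth bounded_linear_vec_nth])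

lemma scalar_holomorphic_on_add:
  assumes "scalar_holomorphic_on f S" "scalar_holomorphic_on g S"
  shows "scalar_holomorphic_on (\<lambda>x. f x + g x) S"
  unfolding scalar_holomorphic_on_def
proof
  fix x assume "x \<in> S"
  then obtain D E where "(f has_derivative D) (at x within S)" "\<forall>c h. D (c *\<^sub>C h) = c * D h"
    "(g has_derivative E) (at x within S)" "\<forall>c h. E (c *\<^sub>C h) = c * E h"
    using assms unfolding scalar_holomorphic_on_def by meson
  then show "\<exists>D. ((\<lambda>x. f x + g x) has_derivative D) (at x within S) \<and> (\<forall>c h. D (c *\<^sub>C h) = c * D h)"
    by (intro exI[of _ "\<lambda>h. D h + E h"]) (auto intro: has_derivative_add simp: algebra_simps)
qed

lemma scalar_holomorphic_on_mult:
  assumes "scalar_holomorphic_on f S" "scalar_holomorphic_on g S"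
  shows "scalar_holomorphic_on (\<lambda>x. f x * g x) S"
  unfolding scalar_holomorphic_on_def
proof
  fix x assume "x \<in> S"
  then obtain D E where "(f has_derivative D) (at x within S)" "\<forall>c h. D (c *\<^sub>C h) = c * D h"
    "(g has_derivative E) (at x within S)" "\<forall>c h. E (c *\<^sub>C h) = c * E h"
    using assms unfolding scalar_holomorphic_on_def by meson
  then show "\<exists>D. ((\<lambda>x. f x * g x) has_derivative D) (at x within S) \<and> (\<forall>c h. D (c *\<^sub>C h) = c * D h)"
    by (intro exI[of _ "\<lambda>h. f x * E h + D h * g x"] conjI has_derivative_mult) (auto simp: algebra_simps)
qed

text \<open>The outer derivative is multiplication by a complex number, so the chain rule preserves
  complex homogeneity. Negation, exponential and reciprocal are all obtained from this rule.\<close>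

lemma scalar_holomorphic_on_compose:
  assumes "scalar_holomorphic_on f S" "g holomorphic_on T" "open T" "\<And>x. x \<in> S \<Longrightarrow> f x \<in> T"
  shows "scalar_holomorphic_on (\<lambda>x. g (f x)) S"
  unfolding scalar_holomorphic_on_def
proof
  fix x assume x: "x \<in> S"
  then obtain D where D: "(f has_derivative D) (at x within S)" "\<forall>c h. D (c *\<^sub>C h) = c * D h"
    using assms unfolding scalar_holomorphic_on_def by meson
  have "(g has_derivative (*) (deriv g (f x))) (at (f x))"
    using holomorphic_derivI[OF assms(2,3) assms(4)[OF x]] by (simp add: has_field_derivative_def)
  from has_derivative_compose[OF D(1) this] D(2)
  show "\<exists>D. ((\<lambda>x. g (f x)) has_derivative D) (at x within S) \<and> (\<forall>c h. D (c *\<^sub>C h) = c * D h)"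
    by (intro exI[of _ "\<lambda>h. deriv g (f x) * D h"]) auto
qed

lemma scalar_holomorphic_on_uminus:
  "scalar_holomorphic_on f S \<Longrightarrow> scalar_holomorphic_on (\<lambda>x. - f x) S"
  by (rule scalar_holomorphic_on_compose[where T = UNIV]) (auto intro: holomorphic_intros)

lemma scalar_holomorphic_on_diff:
  "scalar_holomorphic_on f S \<Longrightarrow> scalar_holomorphic_on g S \<Longrightarrow> scalar_holomorphic_on (\<lambda>x. f x - g x) S"
  using scalar_holomorphic_on_add[of f S "\<lambda>x. - g x"] scalar_holomorphic_on_uminus[of g S] by simp

lemma scalar_holomorphic_on_exp:
  "scalar_holomorphic_on f S \<Longrightarrow> scalar_holomorphic_on (\<lambda>x. exp (f x)) S"
  by (rule scalar_holomorphic_on_compose[where T = UNIV]) (auto intro: holomorphic_intros)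

lemma scalar_holomorphic_on_divide:
  assumes "scalar_holomorphic_on f S" "scalar_holomorphic_on g S" "\<And>x. x \<in> S \<Longrightarrow> g x \<noteq> 0"
  shows "scalar_holomorphic_on (\<lambda>x. f x / g x) S"
proof -
  have "scalar_holomorphic_on (\<lambda>x. inverse (g x)) S"
    by (rule scalar_holomorphic_on_compose[where T = "- {0}"]) (use assms in \<open>auto intro: holomorphic_intros\<close>)
  with assms(1) show ?thesis
    unfolding divide_inverse by (rule scalar_holomorphic_on_mult)
qed

lemmas scalar_holomorphic_intros =
  scalar_holomorphic_on_const scalar_holomorphic_on_nth scalar_holomorphic_on_add
  scalar_holomorphic_on_diff scalar_holomorphic_on_uminus scalar_holomorphic_on_mult
  scalar_holomorphic_on_divide scalar_holomorphic_on_exp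

text \<open>For the converse, linearity of \<open>D\<close> and the limit of the remainder are
  checked in each component, and the finitely many component bounds add up to a bound for
  \<open>D\<close>.\<close>

lemma has_derivative_vec_iff:
  fixes f :: "'a::real_normed_vector \<Rightarrow> 'b::real_normed_vector ^ 'n"
  shows "(f has_derivative D) (at x within S) \<longleftrightarrow>
    (\<forall>i. ((\<lambda>y. f y $ i) has_derivative (\<lambda>h. D h $ i)) (at x within S))"
proof
  assume "(f has_derivative D) (at x within S)"
  then show "\<forall>i. ((\<lambda>y. f y $ i) has_derivative (\<lambda>h. D h $ i)) (at x within S)"
    by (auto intro: bounded_linear.has_derivative[OF bounded_linear_vec_nth])
next
  assume *: "\<forall>i. ((\<lambda>y. f y $ i) has_derivative (\<lambda>h. D h $ i)) (at x within S)"
  have "linear D"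
  proof (rule linearI; unfold vec_eq_iff; rule allI)
    fix a b r i
    have "linear (\<lambda>h. D h $ i)"
      using * by (simp add: has_derivative_def bounded_linear.linear)
    from linear_add[OF this] linear_scale[OF this]
    show "D (a + b) $ i = (D a + D b) $ i" "D (r *\<^sub>R a) $ i = (r *\<^sub>R D a) $ i"
      by simp_all
  qed
  have "\<exists>K. \<forall>h. norm (D h $ i) \<le> norm h * K" for i
    using * bounded_linear.bounded by (fastforce simp: has_derivative_def)
  then obtain K where K: "\<And>i h. norm (D h $ i) \<le> norm h * K i" by metis
  have "bounded_linear D"
  proof (rule bounded_linear_intro)
    show "D (a + b) = D a + D b" "D (r *\<^sub>R a) = r *\<^sub>R D a" for a b r
      using \<open>linear D\<close> by (simp_all add: linear_add linear_scale)
    show "norm (D h) \<le> norm h * (\<Sum>i\<in>UNIV. K i)" for h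
    proof -
      have "norm (D h) \<le> (\<Sum>i\<in>UNIV. norm (D h $ i))"
        by (simp add: norm_vec_def L2_set_le_sum)
      also have "\<dots> \<le> (\<Sum>i\<in>UNIV. norm h * K i)"
        by (intro sum_mono K)
      finally show ?thesis by (simp add: sum_distrib_left)
    qed
  qed
  then show "(f has_derivative D) (at x within S)"
    using * unfolding has_derivative_def by (auto intro: vec_tendstoI)
qed

text \<open>The componentwise criterion for derivatives, applied once to rows and once to entries,
  reduces holomorphy of a matrix to that of its entries.\<close>

lemma matrix_holomorphic_on_iff:
  "matrix_holomorphic_on f S \<longleftrightarrow> (\<forall>i j. scalar_holomorphic_on (\<lambda>x. f x $ i $ j) S)"
proof
  assume f: "matrix_holomorphic_on f S"
  show "\<forall>i j. scalar_holomorphic_on (\<lambda>x. f x $ i $ j) S"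
    unfolding scalar_holomorphic_on_def
  proof (intro allI ballI)
    fix i j x assume "x \<in> S"
    then obtain D where "(f has_derivative D) (at x within S)" "\<And>c h. D (c *\<^sub>C h) = c *\<^sub>C D h"
      using f unfolding matrix_holomorphic_on_def by blast
    then show "\<exists>D. ((\<lambda>x. f x $ i $ j) has_derivative D) (at x within S) \<and> (\<forall>c h. D (c *\<^sub>C h) = c * D h)"
      by (intro exI[of _ "\<lambda>h. D h $ i $ j"]) (simp add: has_derivative_vec_iff)
  qed
next
  assume f: "\<forall>i j. scalar_holomorphic_on (\<lambda>x. f x $ i $ j) S"
  show "matrix_holomorphic_on f S"
    unfolding matrix_holomorphic_on_def
  proof
    fix x assume "x \<in> S"
    then have "\<forall>i j. \<exists>D. ((\<lambda>x. f x $ i $ j) has_derivative D) (at x within S) \<and> (\<forall>c h. D (c *\<^sub>C h) = c * D h)"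
      using f unfolding scalar_holomorphic_on_def by blast
    then obtain D where "\<And>i j. ((\<lambda>x. f x $ i $ j) has_derivative D i j) (at x within S)"
      "\<And>i j c h. D i j (c *\<^sub>C h) = c * D i j h"
      by metis
    then show "\<exists>D. (f has_derivative D) (at x within S) \<and> (\<forall>c h. D (c *\<^sub>C h) = c *\<^sub>C D h)"
      by (intro exI[of _ "\<lambda>h. \<chi> i j. D i j h"]) (simp add: has_derivative_vec_iff vec_eq_iff)
  qed
qed

section \<open>Biholomorphic maps with an explicit inverse\<close>

text \<open>An explicit two-sided inverse \<open>g\<close> agrees with \<open>inv_into\<close> on
  \<open>S\<close>, so its holomorphy is that of the inverse map. The hypotheses are symmetric in
  \<open>f\<close> and \<open>g\<close>; the auxiliary fact \<open>*\<close> serves both.\<close>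

lemma
  assumes f: "matrix_holomorphic_on f S" "\<And>x. x \<in> S \<Longrightarrow> f x \<in> S"
    and g: "matrix_holomorphic_on g S" "\<And>x. x \<in> S \<Longrightarrow> g x \<in> S"
    and gf: "\<And>x. x \<in> S \<Longrightarrow> g (f x) = x" and fg: "\<And>x. x \<in> S \<Longrightarrow> f (g x) = x"
  shows restrict_in_Aut: "restrict f S \<in> carrier (Aut S)"
    and inv_Aut_restrict: "inv\<^bsub>Aut S\<^esub> restrict f S = restrict g S"
proof -
  have *: "restrict f S \<in> biholo S" if f: "matrix_holomorphic_on f S" "\<And>x. x \<in> S \<Longrightarrow> f x \<in> S"
    and g: "matrix_holomorphic_on g S" "\<And>x. x \<in> S \<Longrightarrow> g x \<in> S"
    and gf: "\<And>x. x \<in> S \<Longrightarrow> g (f x) = x" and fg: "\<And>x. x \<in> S \<Longrightarrow> f (g x) = x" for f g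
  proof -
    have bij: "bij_betw (restrict f S) S S"
      by (rule bij_betw_byWitness[where f' = g]) (use that in auto)
    have "inv_into S (restrict f S) y = g y" if "y \<in> S" for y
      by (rule inv_into_f_eq) (use bij that g fg in \<open>auto simp: bij_betw_def\<close>)
    then have "matrix_holomorphic_on (inv_into S (restrict f S)) S"
      using g matrix_holomorphic_on_cong by blast
    moreover have "matrix_holomorphic_on (restrict f S) S"
      using f matrix_holomorphic_on_cong[of S "restrict f S" f] by auto
    ultimately show ?thesis
      using bij by (simp add: biholo_def Bij_def)
  qed
  show f_in: "restrict f S \<in> carrier (Aut S)"
    using *[OF assms] by (simp add: Aut_def)
  have g_in: "restrict g S \<in> carrier (Aut S)"
    using *[OF g f fg gf] by (simp add: Aut_def)
  have "compose S (restrict g S) (restrict f S) = (\<lambda>x\<in>S. x)"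
    using f gf by (auto simp: compose_def)
  then have "restrict g S \<otimes>\<^bsub>Aut S\<^esub> restrict f S = \<one>\<^bsub>Aut S\<^esub>"
    using f_in g_in by (simp add: Aut_def BijGroup_def biholo_def)
  then show "inv\<^bsub>Aut S\<^esub> restrict f S = restrict g S"
    using group.inv_equality[OF group_Aut] f_in g_in by blast
qed

section \<open>The spectral ball\<close>

text \<open>The condition on \<open>k\<close> is the characteristic equation: an eigenvector is a
  nonzero kernel element of \<open>A - mat k\<close>, which exists exactly when the determinant
  vanishes.\<close>

lemma matrix_spectrum_2:
  fixes A :: cmat2
  shows "matrix_spectrum A = {k. k\<^sup>2 - trace A * k + det A = 0}"
proof -
  have "k \<in> matrix_spectrum A \<longleftrightarrow> k\<^sup>2 - trace A * k + det A = 0" for k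
  proof -
    have "k \<in> matrix_spectrum A \<longleftrightarrow> (\<exists>v. v \<noteq> 0 \<and> (A - mat k) *v v = 0)"
      by (simp add: matrix_spectrum_def vec_eq_iff forall_2 matrix_vector_mult_def sum_2 algebra_simps)
    also have "\<dots> \<longleftrightarrow> \<not> invertible (A - mat k)"
      using matrix_left_invertible_ker[of "A - mat k"] by (auto simp: invertible_left_inverse)
    also have "\<dots> \<longleftrightarrow> det (A - mat k) = 0"
      by (simp add: invertible_det_nz)
    also have "det (A - mat k) = k\<^sup>2 - trace A * k + det A"
      by (simp add: det_2 trace_2 power2_eq_square algebra_simps)
    finally show ?thesis .
  qed
  then show ?thesis by auto
qed

text \<open>The spectral radius is a \<open>Max\<close>, which compares as expected only over a
  finite nonempty set. The quadratic formula supplies this by listing the spectrum as two possibly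
  equal roots.\<close>

lemma spectral_ball_iff:
  "x \<in> spectral_ball \<longleftrightarrow> (\<forall>k. k\<^sup>2 - trace x * k + det x = 0 \<longrightarrow> norm k < 1)"
proof -
  define r where "r = csqrt ((trace x)\<^sup>2 - 4 * det x)"
  have r: "r * r = (trace x)\<^sup>2 - 4 * det x"
    by (simp add: r_def flip: power2_eq_square)
  have "4 * (k\<^sup>2 - trace x * k + det x) = (2 * k - (trace x + r)) * (2 * k - (trace x - r))" for k
    using r by algebra
  then have "k\<^sup>2 - trace x * k + det x = 0 \<longleftrightarrow> 2 * k = trace x + r \<or> 2 * k = trace x - r" for k
    by (metis (no_types) eq_iff_diff_eq_0 mult_eq_0_iff zero_neq_numeral)
  moreover have "2 * k = u \<longleftrightarrow> k = u / 2" for k u :: complex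
    by auto
  ultimately have "matrix_spectrum x = {(trace x + r) / 2, (trace x - r) / 2}"
    by (auto simp: matrix_spectrum_2)
  then have "finite (matrix_spectrum x)" "matrix_spectrum x \<noteq> {}" by auto
  then show ?thesis
    by (auto simp: spectral_ball_def matrix_spectral_radius_def matrix_spectrum_2)
qed

lemma spectral_ball_cong:
  "trace x = trace y \<Longrightarrow> det x = det y \<Longrightarrow> x \<in> spectral_ball \<longleftrightarrow> y \<in> spectral_ball"
  by (simp add: spectral_ball_iff)

section \<open>Similarity of matrices\<close>

definition similar :: "'a::field ^ 'n ^ 'n \<Rightarrow> 'a ^ 'n ^ 'n \<Rightarrow> bool"
  where "similar x z \<longleftrightarrow> (\<exists>q. invertible q \<and> z = matrix_inv q ** x ** q)"

lemma similar_trace_det: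
  assumes "similar x z"
  shows "trace z = trace x" "det z = det x"
proof -
  obtain q where q: "invertible q" "z = matrix_inv q ** x ** q"
    using assms by (auto simp: similar_def)
  show "trace z = trace x"
    using q by (metis invertible_matrix_inv(1) matrix_mul_assoc matrix_mul_lid trace_mul_sym)
  have "det q * det (matrix_inv q) = 1"
    by (metis q(1) invertible_matrix_inv(1) det_mul det_I)
  then show "det z = det x"
    using q by (simp add: det_mul mult_ac)
qed

lemma similar_spectral_ball: "similar x z \<Longrightarrow> x \<in> spectral_ball \<Longrightarrow> z \<in> spectral_ball"
  using similar_trace_det spectral_ball_cong by metis

text \<open>The intertwining equation avoids computing an inverse, so similarity can be verified
  entrywise or by adding and scaling equations.\<close>

lemma similarI:
  assumes "invertible q" "q ** z = x ** q"
  shows "similar x z"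
  unfolding similar_def using assms
  by (metis invertible_matrix_inv(2) matrix_mul_assoc matrix_mul_lid)

lemma similar_refl: "similar x x"
  by (rule similarI[of "mat 1"]) (auto simp: invertible_def intro: exI[of _ "mat 1"])

lemma similar_sym:
  assumes "similar x z"
  shows "similar z x"
proof -
  obtain q where q: "invertible q" "z = matrix_inv q ** x ** q"
    using assms by (auto simp: similar_def)
  show ?thesis
  proof (rule similarI)
    show "matrix_inv q ** x = z ** matrix_inv q"
      using q by (simp add: invertible_matrix_inv flip: matrix_mul_assoc)
  qed (use q in \<open>simp add: invertible_matrix_inv\<close>)
qed

lemma similar_trans:
  assumes "similar x y" "similar y z"
  shows "similar x z"
proof -
  obtain q where q: "invertible q" "y = matrix_inv q ** x ** q"
    using assms by (auto simp: similar_def)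
  obtain p where p: "invertible p" "z = matrix_inv p ** y ** p"
    using assms by (auto simp: similar_def)
  have "z = matrix_inv (q ** p) ** x ** (q ** p)"
    using p q by (simp add: matrix_inv_mult matrix_mul_assoc)
  then show ?thesis
    using p q invertible_mult unfolding similar_def by blast
qed

lemma transpose_invertible_field:
  fixes A :: "'a::field ^ 'n ^ 'n"
  shows "invertible A \<Longrightarrow> invertible (transpose A)"
  by (simp add: invertible_det_nz)

text \<open>Transposition reverses products, so the intertwiner becomes the transpose of the inverse
  of \<open>q\<close>.\<close>

lemma similar_transpose:
  fixes x z :: "'a::field ^ 'n ^ 'n"
  assumes "similar x z"
  shows "similar (transpose x) (transpose z)"
proof -
  obtain q where q: "invertible q" "z = matrix_inv q ** x ** q"
    using assms by (auto simp: similar_def)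
  show ?thesis
  proof (rule similarI)
    show "invertible (transpose (matrix_inv q))"
      using q invertible_matrix_inv(3) transpose_invertible_field by blast
    have "z ** matrix_inv q = matrix_inv q ** x"
      using q by (simp add: invertible_matrix_inv flip: matrix_mul_assoc)
    then show "transpose (matrix_inv q) ** transpose z = transpose x ** transpose (matrix_inv q)"
      by (metis matrix_transpose_mul)
  qed
qed

lemma spectral_ball_iff_eigenvalue:
  "x \<in> spectral_ball \<longleftrightarrow> (\<forall>k v. v \<noteq> 0 \<longrightarrow> x *v v = k *s v \<longrightarrow> norm k < 1)"
proof -
  have "x \<in> spectral_ball \<longleftrightarrow> (\<forall>k\<in>matrix_spectrum x. norm k < 1)"
    by (simp add: spectral_ball_iff matrix_spectrum_2)
  then show ?thesis by (auto simp: matrix_spectrum_def)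
qed

section \<open>Moebius maps\<close>

text \<open>Both claims follow from |1 - cnj a l|^2 - |l - a|^2 = (1 - |a|^2)(1 - |l|^2), whose
  right side is positive on the disc.\<close>

lemma norm_moebius_less_1:
  fixes a l :: complex
  assumes "norm a < 1" "norm l < 1"
  shows "1 - cnj a * l \<noteq> 0" "norm ((l - a) / (1 - cnj a * l)) < 1"
proof -
  have "(norm (1 - cnj a * l))\<^sup>2 - (norm (l - a))\<^sup>2 = (1 - (norm a)\<^sup>2) * (1 - (norm l)\<^sup>2)"
    unfolding cmod_power2 by (simp add: power2_eq_square algebra_simps)
  also have "\<dots> > 0"
    using assms by (simp add: abs_square_less_1)
  finally have *: "(norm (l - a))\<^sup>2 < (norm (1 - cnj a * l))\<^sup>2" by simp
  then show nz: "1 - cnj a * l \<noteq> 0" by auto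
  have "norm (l - a) < norm (1 - cnj a * l)"
    using * by (rule power2_less_imp_less) simp
  then show "norm ((l - a) / (1 - cnj a * l)) < 1"
    using nz by (simp add: norm_divide)
qed

text \<open>The expression is the determinant of \<open>mat 1 - cnj \<alpha> *\<^sub>C x\<close>. If
  it vanished, 1 / cnj \<alpha> would be an eigenvalue of \<open>x\<close> of modulus greater than
  1.\<close>

lemma moebius_denominator_nonzero:
  assumes "norm \<alpha> < 1" "x \<in> spectral_ball"
  shows "1 - cnj \<alpha> * trace x + (cnj \<alpha>)\<^sup>2 * det x \<noteq> 0"
proof
  assume 0: "1 - cnj \<alpha> * trace x + (cnj \<alpha>)\<^sup>2 * det x = 0"
  then have "\<alpha> \<noteq> 0" by auto
  then have "(1 / cnj \<alpha>)\<^sup>2 - trace x * (1 / cnj \<alpha>) + det x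
      = (1 - cnj \<alpha> * trace x + (cnj \<alpha>)\<^sup>2 * det x) / (cnj \<alpha>)\<^sup>2"
    by (simp add: field_simps power2_eq_square)
  with 0 assms(2) have "norm (1 / cnj \<alpha>) < 1"
    by (auto simp: spectral_ball_iff)
  with assms(1) \<open>\<alpha> \<noteq> 0\<close> show False
    by (simp add: norm_divide)
qed

lemma matrix_inv_moebius_denominator:
  assumes "norm \<alpha> < 1" "x \<in> spectral_ball"
  shows "(mat 1 - cnj \<alpha> *\<^sub>C x) ** matrix_inv (mat 1 - cnj \<alpha> *\<^sub>C x) = mat 1"
proof -
  have "det (mat 1 - cnj \<alpha> *\<^sub>C x) = 1 - cnj \<alpha> * trace x + (cnj \<alpha>)\<^sup>2 * det x"
    by (simp add: det_2 trace_2 power2_eq_square algebra_simps)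
  then have "invertible (mat 1 - cnj \<alpha> *\<^sub>C x)"
    using moebius_denominator_nonzero[OF assms] by (simp add: invertible_det_nz)
  then show ?thesis by (rule invertible_matrix_inv)
qed

text \<open>In dimension two the adjugate of a matrix is its trace times the identity minus the
  matrix, so the inverse in a Moebius map is affine in \<open>x\<close> up to the factor 1 /
  \<open>p\<close>. Both coefficients depend on \<open>x\<close> only through its trace and
  determinant, hence are constant on similarity classes.\<close>

lemma moebius_affine:
  assumes "norm \<alpha> < 1" "x \<in> spectral_ball"
  defines "p \<equiv> 1 - cnj \<alpha> * trace x + (cnj \<alpha>)\<^sup>2 * det x"
  shows "moebius \<alpha> \<gamma> x = (\<gamma> * (1 - \<alpha> * cnj \<alpha>) / p) *\<^sub>C x
    + (\<gamma> * (\<alpha> * cnj \<alpha> * trace x - cnj \<alpha> * det x - \<alpha>) / p) *\<^sub>C mat 1"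
proof -
  \<comment> \<open>The adjugate of \<open>mat 1 - cnj \<alpha> *\<^sub>C x\<close> divided by its
    determinant \<open>p\<close>.\<close>
  let ?Y = "(1 / p) *\<^sub>C ((1 - cnj \<alpha> * trace x) *\<^sub>C mat 1 + cnj \<alpha> *\<^sub>C x)"
  have p: "p \<noteq> 0" unfolding p_def by (rule moebius_denominator_nonzero[OF assms(1,2)])
  have "(mat 1 - cnj \<alpha> *\<^sub>C x) ** ((1 - cnj \<alpha> * trace x) *\<^sub>C mat 1 + cnj \<alpha> *\<^sub>C x) = p *\<^sub>C mat 1"
    by (simp add: mat2_eq_iff matrix_mult_2 p_def det_2 trace_2 power2_eq_square algebra_simps)
  then have "(mat 1 - cnj \<alpha> *\<^sub>C x) ** ?Y = mat 1"
    using p by (simp add: cscale_mult_right) (simp add: mat2_eq_iff)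
  then have "matrix_inv (mat 1 - cnj \<alpha> *\<^sub>C x) = ?Y"
    by (rule matrix_inv_unique)
  then have "moebius \<alpha> \<gamma> x = (\<gamma> / p) *\<^sub>C ((x - \<alpha> *\<^sub>C mat 1) ** ((1 - cnj \<alpha> * trace x) *\<^sub>C mat 1 + cnj \<alpha> *\<^sub>C x))"
    by (simp add: moebius_def cscale_mult_right) (simp add: mat2_eq_iff)
  \<comment> \<open>The quadratic term is removed by Cayley--Hamilton, here checked
    entrywise.\<close>
  also have "(x - \<alpha> *\<^sub>C mat 1) ** ((1 - cnj \<alpha> * trace x) *\<^sub>C mat 1 + cnj \<alpha> *\<^sub>C x)
      = (1 - \<alpha> * cnj \<alpha>) *\<^sub>C x + (\<alpha> * cnj \<alpha> * trace x - cnj \<alpha> * det x - \<alpha>) *\<^sub>C mat 1"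
    by (simp add: mat2_eq_iff matrix_mult_2 det_2 trace_2 algebra_simps)
  finally show ?thesis
    by (simp add: mat2_eq_iff add_divide_distrib diff_divide_distrib algebra_simps)
qed

text \<open>An eigenvector \<open>v\<close> of the image for \<open>k\<close> gives the eigenvector
  \<open>w\<close> of \<open>x\<close>, with an eigenvalue \<open>l\<close> that the scalar Moebius
  map carries to \<open>k\<close>. The scalar map preserves the unit disc.\<close>

lemma moebius_in_spectral_ball:
  assumes \<alpha>: "norm \<alpha> < 1" and \<gamma>: "norm \<gamma> = 1" and x: "x \<in> spectral_ball"
  shows "moebius \<alpha> \<gamma> x \<in> spectral_ball"
  unfolding spectral_ball_iff_eigenvalue
proof (intro allI impI)
  fix k v assume v: "v \<noteq> 0" "moebius \<alpha> \<gamma> x *v v = k *s v"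
  define w where "w = matrix_inv (mat 1 - cnj \<alpha> *\<^sub>C x) *v v"
  have v_w: "v = (mat 1 - cnj \<alpha> *\<^sub>C x) *v w"
    by (simp add: w_def matrix_vector_mul_assoc matrix_inv_moebius_denominator[OF \<alpha> x])
  then have "w \<noteq> 0" using v(1) by auto
  have "moebius \<alpha> \<gamma> x *v v = (\<gamma> *\<^sub>C (x - \<alpha> *\<^sub>C mat 1)) *v w"
    by (simp add: moebius_def w_def matrix_vector_mul_assoc cscale_mult_left)
  with v v_w have "(\<gamma> *\<^sub>C (x - \<alpha> *\<^sub>C mat 1)) *v w = k *s ((mat 1 - cnj \<alpha> *\<^sub>C x) *v w)"
    by simp
  then have kw: "(\<gamma> + k * cnj \<alpha>) *s (x *v w) = (k + \<gamma> * \<alpha>) *s w"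
    by (simp add: vec_eq_iff forall_2 matrix_vector_mult_def sum_2 algebra_simps)
  have aa: "\<alpha> * cnj \<alpha> \<noteq> 1"
    using norm_moebius_less_1(1)[OF \<alpha> \<alpha>] by (simp add: mult.commute)
  \<comment> \<open>If this coefficient vanished, the other side of \<open>kw\<close> would force k
    = -\<gamma>\<alpha> as well, and then \<gamma>(1 - |\<alpha>|^2) = 0.\<close>
  have nz: "\<gamma> + k * cnj \<alpha> \<noteq> 0"
  proof
    assume 0: "\<gamma> + k * cnj \<alpha> = 0"
    have "(k + \<gamma> * \<alpha>) *s w = 0" using kw unfolding 0 by simp
    with \<open>w \<noteq> 0\<close> have "k + \<gamma> * \<alpha> = 0" by (simp only: vec.scale_eq_0_iff simp_thms)
    then have "k = - \<gamma> * \<alpha>" by (simp add: eq_neg_iff_add_eq_0)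
    with 0 have "\<gamma> * (1 - \<alpha> * cnj \<alpha>) = 0" by (simp add: algebra_simps)
    with aa \<gamma> show False by auto
  qed
  \<comment> \<open>The preimage of \<open>k\<close> under the scalar Moebius map.\<close>
  define l where "l = (k + \<gamma> * \<alpha>) / (\<gamma> + k * cnj \<alpha>)"
  have l: "l * (\<gamma> + k * cnj \<alpha>) = k + \<gamma> * \<alpha>"
    using nz by (simp add: l_def)
  have "x *v w = inverse (\<gamma> + k * cnj \<alpha>) *s ((\<gamma> + k * cnj \<alpha>) *s (x *v w))"
    by (simp only: vec.scale_scale left_inverse[OF nz] vec.scale_one)
  also have "\<dots> = l *s w"
    by (simp only: kw vec.scale_scale l_def divide_inverse mult.commute)
  finally have "norm l < 1"
    using x \<open>w \<noteq> 0\<close> unfolding spectral_ball_iff_eigenvalue by blast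
  note * = norm_moebius_less_1[OF \<alpha> this]
  have "k * (1 - cnj \<alpha> * l) = \<gamma> * (l - \<alpha>)"
    using l by (simp add: algebra_simps)
  then have "k = \<gamma> * ((l - \<alpha>) / (1 - cnj \<alpha> * l))"
    using *(1) by (simp add: field_simps)
  then show "norm k < 1"
    using *(2) \<gamma> by (simp only: norm_mult)
qed

text \<open>The parameters are those of the inverse scalar Moebius map. Multiplying by the
  denominator \<open>X\<close> of the inner map turns everything into polynomial identities in
  \<open>x\<close>.\<close>

lemma moebius_inverse:
  assumes \<alpha>: "norm \<alpha> < 1" and \<gamma>: "norm \<gamma> = 1" and x: "x \<in> spectral_ball"
  shows "moebius (- \<gamma> * \<alpha>) (cnj \<gamma>) (moebius \<alpha> \<gamma> x) = x"
proof -
  let ?s = "1 - \<alpha> * cnj \<alpha>"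
  define X where "X = mat 1 - cnj \<alpha> *\<^sub>C x"
  define y where "y = moebius \<alpha> \<gamma> x"
  have s: "?s \<noteq> 0"
    using norm_moebius_less_1(1)[OF \<alpha> \<alpha>] by (simp add: mult.commute)
  have \<gamma>': "cnj \<gamma> * \<gamma> = 1"
    using \<gamma> by (simp add: complex_norm_square[symmetric] mult.commute)
  have "matrix_inv X ** X = mat 1"
    using matrix_inv_moebius_denominator[OF \<alpha> x] by (simp add: X_def matrix_left_right_inverse)
  then have yX: "y ** X = \<gamma> *\<^sub>C (x - \<alpha> *\<^sub>C mat 1)"
    by (simp add: y_def moebius_def cscale_mult_left flip: X_def matrix_mul_assoc)
  \<comment> \<open>The denominator of the outer map. Its product with \<open>X\<close> is the
    scalar matrix \<open>?s\<close>, so its inverse is \<open>X\<close> divided by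
    \<open>?s\<close>.\<close>
  let ?Z = "mat 1 - cnj (- \<gamma> * \<alpha>) *\<^sub>C y"
  have "?Z ** X = X + (cnj \<gamma> * cnj \<alpha>) *\<^sub>C (y ** X)"
    by (simp add: mat2_eq_iff matrix_mult_2 algebra_simps)
  also have "\<dots> = X + (cnj \<gamma> * \<gamma> * cnj \<alpha>) *\<^sub>C (x - \<alpha> *\<^sub>C mat 1)"
    unfolding yX by (simp add: mat2_eq_iff algebra_simps)
  also have "\<dots> = ?s *\<^sub>C mat 1"
    unfolding \<gamma>' by (simp add: X_def mat2_eq_iff algebra_simps)
  finally have "?Z ** ((1 / ?s) *\<^sub>C X) = mat 1"
    using s by (simp add: cscale_mult_right) (simp add: mat2_eq_iff)
  then have "matrix_inv ?Z = (1 / ?s) *\<^sub>C X"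
    by (rule matrix_inv_unique)
  then have "moebius (- \<gamma> * \<alpha>) (cnj \<gamma>) y = (cnj \<gamma> / ?s) *\<^sub>C ((y + (\<gamma> * \<alpha>) *\<^sub>C mat 1) ** X)"
    by (simp add: moebius_def cscale_mult_right) (simp add: mat2_eq_iff matrix_mult_2 algebra_simps)
  also have "(y + (\<gamma> * \<alpha>) *\<^sub>C mat 1) ** X = y ** X + (\<gamma> * \<alpha>) *\<^sub>C X"
    by (simp add: mat2_eq_iff matrix_mult_2 algebra_simps)
  also have "\<dots> = (\<gamma> * ?s) *\<^sub>C x"
    unfolding yX by (simp add: X_def mat2_eq_iff algebra_simps)
  also have "(cnj \<gamma> / ?s) *\<^sub>C (\<gamma> * ?s) *\<^sub>C x = (cnj \<gamma> * \<gamma>) *\<^sub>C x"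
    using s by (simp add: mat2_eq_iff)
  finally show ?thesis
    unfolding \<gamma>' by (simp add: y_def mat2_eq_iff)
qed

lemma moebius_holomorphic:
  assumes "norm \<alpha> < 1"
  shows "matrix_holomorphic_on (moebius \<alpha> \<gamma>) spectral_ball"
proof -
  let ?p = "\<lambda>x. 1 - cnj \<alpha> * trace x + (cnj \<alpha>)\<^sup>2 * det x"
  let ?m = "\<lambda>x. (\<gamma> * (1 - \<alpha> * cnj \<alpha>) / ?p x) *\<^sub>C x
    + (\<gamma> * (\<alpha> * cnj \<alpha> * trace x - cnj \<alpha> * det x - \<alpha>) / ?p x) *\<^sub>C mat 1"
  have "scalar_holomorphic_on (\<lambda>x. ?m x $ i $ j) spectral_ball" for i j
    unfolding vector_add_component cscale_nth
    unfolding trace_2 det_2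
    by (intro scalar_holomorphic_intros)
      (use moebius_denominator_nonzero[OF assms, unfolded trace_2 det_2] in auto)
  then have "matrix_holomorphic_on ?m spectral_ball"
    by (simp only: matrix_holomorphic_on_iff) blast
  then show ?thesis
    using matrix_holomorphic_on_cong[of spectral_ball "moebius \<alpha> \<gamma>" ?m] moebius_affine[OF assms] by blast
qed

lemma moebius_Aut:
  assumes "norm \<alpha> < 1" "norm \<gamma> = 1"
  shows "restrict (moebius \<alpha> \<gamma>) spectral_ball \<in> carrier (Aut spectral_ball)"
    "inv\<^bsub>Aut spectral_ball\<^esub> restrict (moebius \<alpha> \<gamma>) spectral_ball
      = restrict (moebius (- \<gamma> * \<alpha>) (cnj \<gamma>)) spectral_ball"
proof -
  have n: "norm (- \<gamma> * \<alpha>) < 1" "norm (cnj \<gamma>) = 1"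
    using assms by (simp_all add: norm_mult)
  \<comment> \<open>The passage to the inverse parameters is an involution, because |\<gamma>| = 1,
    so the other order of composition is an instance of \<open>moebius_inverse\<close>.\<close>
  have "moebius \<alpha> \<gamma> (moebius (- \<gamma> * \<alpha>) (cnj \<gamma>) x) = x" if "x \<in> spectral_ball" for x
  proof -
    have "cnj \<gamma> * \<gamma> = 1"
      using assms(2) by (simp add: complex_norm_square[symmetric] mult.commute)
    then have "cnj \<gamma> * (\<gamma> * \<alpha>) = \<alpha>"
      by (simp flip: mult.assoc)
    then show ?thesis
      using moebius_inverse[OF n that] by (simp only: complex_cnj_cnj minus_mult_minus minus_mult_left[symmetric] minus_mult_right[symmetric] minus_minus)
  qed
  note * = moebius_holomorphic[OF assms(1)] moebius_in_spectral_ball[OF assms]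
    moebius_holomorphic[OF n(1)] moebius_in_spectral_ball[OF n] moebius_inverse[OF assms] this
  show "restrict (moebius \<alpha> \<gamma>) spectral_ball \<in> carrier (Aut spectral_ball)"
    by (rule restrict_in_Aut[OF *])
  show "inv\<^bsub>Aut spectral_ball\<^esub> restrict (moebius \<alpha> \<gamma>) spectral_ball
      = restrict (moebius (- \<gamma> * \<alpha>) (cnj \<gamma>)) spectral_ball"
    by (rule inv_Aut_restrict[OF *])
qed

section \<open>Transposition, conjugations and twists\<close>

lemma transpose_in_spectral_ball: "x \<in> spectral_ball \<Longrightarrow> transpose x \<in> spectral_ball"
  using spectral_ball_cong[OF _ det_transpose, of x] by (simp add: trace_def transpose_def)

lemma transpose_Aut:
  "restrict transpose spectral_ball \<in> carrier (Aut spectral_ball)"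
  "inv\<^bsub>Aut spectral_ball\<^esub> restrict transpose spectral_ball = restrict transpose spectral_ball"
proof -
  have "matrix_holomorphic_on transpose spectral_ball"
    by (simp add: matrix_holomorphic_on_iff transpose_def scalar_holomorphic_on_nth)
  then show "restrict transpose spectral_ball \<in> carrier (Aut spectral_ball)"
    "inv\<^bsub>Aut spectral_ball\<^esub> restrict transpose spectral_ball = restrict transpose spectral_ball"
    by (auto intro!: restrict_in_Aut inv_Aut_restrict transpose_in_spectral_ball)
qed

lemma matrix_holomorphic_on_matrix_inv:
  fixes u :: "complex ^ 'n ^ 'm \<Rightarrow> cmat2"
  assumes "matrix_holomorphic_on u S" "\<And>x. x \<in> S \<Longrightarrow> invertible (u x)"
  shows "matrix_holomorphic_on (\<lambda>x. matrix_inv (u x)) S"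
proof -
  have nz: "u x $ 1 $ 1 * u x $ 2 $ 2 - u x $ 1 $ 2 * u x $ 2 $ 1 \<noteq> 0" if "x \<in> S" for x
    using assms(2)[OF that] by (simp add: invertible_det_nz det_2)
  have h: "scalar_holomorphic_on (\<lambda>x. u x $ i $ j) S" for i j
    using assms(1) by (simp add: matrix_holomorphic_on_iff)
  have "matrix_holomorphic_on (\<lambda>x. vector [vector [u x$2$2 / det (u x), - u x$1$2 / det (u x)],
      vector [- u x$2$1 / det (u x), u x$1$1 / det (u x)]] :: cmat2) S"
    unfolding matrix_holomorphic_on_iff forall_2 vector_2 det_2
    using nz by (auto intro!: scalar_holomorphic_intros h)
  then show ?thesis
    by (subst matrix_holomorphic_on_cong[OF matrix_inv_2]) (use assms(2) in \<open>auto simp: invertible_det_nz\<close>)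
qed

lemma matrix_holomorphic_on_mult:
  fixes f g :: "complex ^ 'n ^ 'm \<Rightarrow> cmat2"
  assumes "matrix_holomorphic_on f S" "matrix_holomorphic_on g S"
  shows "matrix_holomorphic_on (\<lambda>x. f x ** g x) S"
  using assms unfolding matrix_holomorphic_on_iff matrix_mult_2
  by (auto intro!: scalar_holomorphic_intros)

text \<open>This keeps the inverse of a conjugation within the same family.\<close>

lemma conj_invariant_holomorphic_matrix_inv:
  "conj_invariant_holomorphic u \<Longrightarrow> conj_invariant_holomorphic (\<lambda>x. matrix_inv (u x))"
  unfolding conj_invariant_holomorphic_def
  by (auto intro!: matrix_holomorphic_on_matrix_inv simp: invertible_matrix_inv)

lemma conj_invariant_holomorphic_similar:
  assumes "conj_invariant_holomorphic u" "similar x z" "x \<in> spectral_ball"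
  shows "u z = u x"
  using assms unfolding conj_invariant_holomorphic_def similar_def by blast

lemma similar_conjugation:
  assumes "conj_invariant_holomorphic u" "x \<in> spectral_ball"
  shows "similar x (conjugation u x)"
  using assms unfolding conj_invariant_holomorphic_def similar_def conjugation_def by blast

text \<open>Conjugation moves \<open>x\<close> inside its similarity class, where \<open>u\<close>
  is constant, so the second conjugation undoes the first with the same matrix.\<close>

lemma conjugation_inverse:
  assumes u: "conj_invariant_holomorphic u" and x: "x \<in> spectral_ball"
  shows "conjugation (\<lambda>x. matrix_inv (u x)) (conjugation u x) = x"
proof -
  have inv: "invertible (u x)" using u x by (simp add: conj_invariant_holomorphic_def)
  have "u (conjugation u x) = u x"
    using conj_invariant_holomorphic_similar[OF u similar_conjugation[OF u x] x] .
  then have "conjugation (\<lambda>x. matrix_inv (u x)) (conjugation u x)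
      = (u x ** matrix_inv (u x)) ** x ** (u x ** matrix_inv (u x))"
    by (simp add: conjugation_def invertible_matrix_inv(4) inv matrix_mul_assoc)
  then show ?thesis by (simp add: invertible_matrix_inv inv)
qed

lemma conjugation_Aut:
  assumes u: "conj_invariant_holomorphic u"
  shows "restrict (conjugation u) spectral_ball \<in> carrier (Aut spectral_ball)"
    "inv\<^bsub>Aut spectral_ball\<^esub> restrict (conjugation u) spectral_ball
      = restrict (conjugation (\<lambda>x. matrix_inv (u x))) spectral_ball"
proof -
  let ?v = "\<lambda>x. matrix_inv (u x)"
  have v: "conj_invariant_holomorphic ?v"
    by (rule conj_invariant_holomorphic_matrix_inv[OF u])
  have holo: "matrix_holomorphic_on (conjugation w) spectral_ball"
    if "conj_invariant_holomorphic w" for w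
    using that unfolding conjugation_def conj_invariant_holomorphic_def
    by (intro matrix_holomorphic_on_mult matrix_holomorphic_on_matrix_inv matrix_holomorphic_on_id) auto
  have mem: "conjugation w x \<in> spectral_ball"
    if "conj_invariant_holomorphic w" "x \<in> spectral_ball" for w x
    using similar_spectral_ball similar_conjugation that by blast
  \<comment> \<open>The previous lemma for \<open>?v\<close> conjugates by a double inverse. This is
    \<open>u\<close> where \<open>u\<close> is invertible, so the intermediate point must lie in the
    ball.\<close>
  have "conjugation u (conjugation ?v x) = x" if "x \<in> spectral_ball" for x
  proof -
    have "invertible (u (conjugation ?v x))"
      using u mem[OF v that] by (simp add: conj_invariant_holomorphic_def)
    then show ?thesis
      using conjugation_inverse[OF v that] by (simp add: conjugation_def invertible_matrix_inv)
  qed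
  note * = holo[OF u] mem[OF u] holo[OF v] mem[OF v] conjugation_inverse[OF u] this
  show "restrict (conjugation u) spectral_ball \<in> carrier (Aut spectral_ball)"
    by (rule restrict_in_Aut[OF *])
  show "inv\<^bsub>Aut spectral_ball\<^esub> restrict (conjugation u) spectral_ball
      = restrict (conjugation ?v) spectral_ball"
    by (rule inv_Aut_restrict[OF *])
qed

lemma exp_mult_exp_minus: "exp (a :: complex) * exp (- a) = 1" "exp (- a) * exp a = 1"
  by (simp_all add: exp_minus)

text \<open>The exponential factors cancel in the product of the off-diagonal entries. Hence trace
  and determinant are preserved, and the twist by the negated function, which sees the same product,
  is the inverse.\<close>

lemma twist_Aut:
  assumes "\<phi> holomorphic_on UNIV"
  shows "restrict (twist \<phi>) spectral_ball \<in> carrier (Aut spectral_ball)"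
proof -
  have prod: "exp (- a) * y * (exp a * z) = y * z" for a y z :: complex
    by (metis exp_mult_exp_minus(2) mult.assoc mult.commute mult.left_neutral)
  have holo: "matrix_holomorphic_on (twist \<psi>) spectral_ball" if "\<psi> holomorphic_on UNIV" for \<psi>
    unfolding matrix_holomorphic_on_iff twist_def forall_2 vector_2
    by (intro conjI scalar_holomorphic_intros scalar_holomorphic_on_compose[OF _ that open_UNIV]) auto
  have mem: "twist \<psi> x \<in> spectral_ball" if "x \<in> spectral_ball" for \<psi> x
    by (rule iffD1[OF spectral_ball_cong that]) (simp_all add: trace_2 det_2 twist_def prod)
  have inverse: "twist (\<lambda>z. - \<psi> z) (twist \<psi> x) = x" for \<psi> x
  proof -
    have "twist \<psi> x $ 1 $ 2 * twist \<psi> x $ 2 $ 1 = x $ 1 $ 2 * x $ 2 $ 1"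
      by (simp only: twist_def vector_2 prod)
    then show ?thesis
      unfolding twist_def[of "\<lambda>z. - \<psi> z"]
      by (simp add: mat2_eq_iff) (simp add: twist_def exp_mult_exp_minus flip: mult.assoc)
  qed
  have "(\<lambda>z. - \<phi> z) holomorphic_on UNIV"
    using assms by (intro holomorphic_intros)
  then show ?thesis
    using restrict_in_Aut[OF holo[OF assms] mem holo mem inverse] inverse[of "\<lambda>z. - \<phi> z"] by simp
qed

section \<open>Maps that are affine on similarity classes\<close>

text \<open>The affine formula may change from class to class, and \<open>linear\<close> means
  real-linear. The clause on \<open>similar\<close> says that classes go into classes, which makes
  the property stable under composition.\<close>

definition affine_on_classes :: "(cmat2 \<Rightarrow> cmat2) \<Rightarrow> bool"
  where "affine_on_classes g \<longleftrightarrow> (\<forall>x\<in>spectral_ball. \<exists>A B. linear A \<and>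
    (\<forall>z. similar x z \<longrightarrow> g z = A z + B \<and> similar (g x) (g z)))"

lemma affine_on_classes_restrict:
  assumes "\<And>x z. x \<in> spectral_ball \<Longrightarrow> similar x z \<Longrightarrow> g z = A x z + B x \<and> similar (g x) (g z)"
    and "\<And>x. x \<in> spectral_ball \<Longrightarrow> linear (A x)"
  shows "affine_on_classes (restrict g spectral_ball)"
  unfolding affine_on_classes_def
proof
  fix x :: cmat2 assume x: "x \<in> spectral_ball"
  show "\<exists>A B. linear A \<and> (\<forall>z. similar x z \<longrightarrow> restrict g spectral_ball z = A z + B \<and>
      similar (restrict g spectral_ball x) (restrict g spectral_ball z))"
    using assms[OF x] similar_spectral_ball[OF _ x] x
    by (intro exI[of _ "A x"] exI[of _ "B x"]) (metis restrict_apply')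
qed

text \<open>On the class of \<open>x\<close> the values of \<open>g\<close> stay in the class of
  \<open>g x\<close>, where a single affine formula for \<open>f\<close> applies.\<close>

lemma affine_on_classes_compose:
  assumes f: "affine_on_classes f" and g: "affine_on_classes g"
    and "\<And>x. x \<in> spectral_ball \<Longrightarrow> g x \<in> spectral_ball"
  shows "affine_on_classes (compose spectral_ball f g)"
  unfolding affine_on_classes_def
proof
  fix x :: cmat2 assume x: "x \<in> spectral_ball"
  obtain A B where AB: "linear A" "\<And>z. similar x z \<Longrightarrow> g z = A z + B \<and> similar (g x) (g z)"
    using g x unfolding affine_on_classes_def by blast
  obtain A' B' where AB': "linear A'"
    "\<And>z. similar (g x) z \<Longrightarrow> f z = A' z + B' \<and> similar (f (g x)) (f z)"
    using f assms(3)[OF x] unfolding affine_on_classes_def by blast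
  have fg: "f (g z) = (A' \<circ> A) z + (A' B + B')" "similar (f (g x)) (f (g z))" if "similar x z" for z
  proof -
    have gz: "g z = A z + B" "similar (g x) (g z)" using AB(2)[OF that] by blast+
    have "f (g z) = A' (g z) + B'" "similar (f (g x)) (f (g z))" using AB'(2)[OF gz(2)] by blast+
    then show "f (g z) = (A' \<circ> A) z + (A' B + B')" "similar (f (g x)) (f (g z))"
      by (simp_all add: gz(1) linear_add[OF AB'(1)] add.assoc)
  qed
  have "linear (A' \<circ> A)" using AB(1) AB'(1) by (rule linear_compose)
  moreover have "compose spectral_ball f g z = f (g z)" if "similar x z" for z
    using similar_spectral_ball[OF that x] by (simp add: compose_eq)
  ultimately show "\<exists>A B. linear A \<and> (\<forall>z. similar x z \<longrightarrow> compose spectral_ball f g z = A z + B \<and>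
      similar (compose spectral_ball f g x) (compose spectral_ball f g z))"
    using fg similar_refl by metis
qed

lemma linear_cscale: "linear ((*\<^sub>C) c)"
  by (rule linearI) (simp_all add: vec_eq_iff algebra_simps)

lemma affine_on_classes_moebius:
  assumes "norm \<alpha> < 1"
  shows "affine_on_classes (restrict (moebius \<alpha> \<gamma>) spectral_ball)"
proof -
  define c where "c t d = \<gamma> * (1 - \<alpha> * cnj \<alpha>) / (1 - cnj \<alpha> * t + (cnj \<alpha>)\<^sup>2 * d)" for t d
  define e where "e t d = \<gamma> * (\<alpha> * cnj \<alpha> * t - cnj \<alpha> * d - \<alpha>) / (1 - cnj \<alpha> * t + (cnj \<alpha>)\<^sup>2 * d)" for t d
  have eq: "moebius \<alpha> \<gamma> z = c (trace z) (det z) *\<^sub>C z + e (trace z) (det z) *\<^sub>C mat 1"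
    if "z \<in> spectral_ball" for z
    using moebius_affine[OF assms that] by (simp add: c_def e_def)
  show ?thesis
  proof (rule affine_on_classes_restrict)
    fix x z assume x: "x \<in> spectral_ball" and xz: "similar x z"
    let ?c = "c (trace x) (det x)" and ?e = "e (trace x) (det x)"
    have z: "z \<in> spectral_ball" using x xz similar_spectral_ball by blast
    have ez: "moebius \<alpha> \<gamma> z = ?c *\<^sub>C z + ?e *\<^sub>C mat 1"
      using eq[OF z] similar_trace_det[OF xz] by simp
    obtain q where q: "invertible q" "z = matrix_inv q ** x ** q"
      using xz by (auto simp: similar_def)
    \<comment> \<open>A matrix intertwining \<open>z\<close> and \<open>x\<close> also intertwines
      the same affine expression in each of them.\<close>
    have "q ** z = x ** q"
      using q by (simp add: matrix_mul_assoc invertible_matrix_inv)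
    then have "similar (moebius \<alpha> \<gamma> x) (moebius \<alpha> \<gamma> z)"
      using q(1) unfolding ez eq[OF x]
      by (intro similarI[of q]) (simp_all add: matrix_add_ldistrib matrix_add_rdistrib cscale_mult_left cscale_mult_right)
    then show "moebius \<alpha> \<gamma> z = ?c *\<^sub>C z + ?e *\<^sub>C mat 1 \<and> similar (moebius \<alpha> \<gamma> x) (moebius \<alpha> \<gamma> z)"
      using ez by blast
  qed (rule linear_cscale)
qed

lemma affine_on_classes_transpose: "affine_on_classes (restrict transpose spectral_ball)"
proof (rule affine_on_classes_restrict)
  show "linear (transpose :: cmat2 \<Rightarrow> cmat2)"
    by (rule linearI) (simp_all add: transpose_def vec_eq_iff)
qed (use similar_transpose in \<open>auto simp: add.right_neutral[of "transpose _"]\<close>)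

text \<open>On a class \<open>u\<close> is a fixed matrix, so conjugation is linear there. Images
  stay similar because each one is similar to its argument.\<close>

lemma affine_on_classes_conjugation:
  assumes u: "conj_invariant_holomorphic u"
  shows "affine_on_classes (restrict (conjugation u) spectral_ball)"
proof (rule affine_on_classes_restrict)
  fix x z assume x: "x \<in> spectral_ball" and xz: "similar x z"
  then have z: "z \<in> spectral_ball" using similar_spectral_ball by blast
  have "similar (conjugation u x) (conjugation u z)"
    using similar_sym[OF similar_conjugation[OF u x]] xz similar_conjugation[OF u z] similar_trans by blast
  then show "conjugation u z = matrix_inv (u x) ** z ** u x + 0 \<and> similar (conjugation u x) (conjugation u z)"
    using conj_invariant_holomorphic_similar[OF u xz x] by (simp add: conjugation_def)
next
  show "linear (\<lambda>z. matrix_inv (u x) ** z ** u x)" for x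
    by (rule linearI) (simp_all add: matrix_add_ldistrib matrix_add_rdistrib scalar_matrix_assoc flip: matrix_scalar_ac)
qed

section \<open>The subgroup generated by the standard automorphisms\<close>

text \<open>Closure of the generating set under inverses means that affinity of an inverse generator
  is again affinity of a generator.\<close>

lemma standard_automorphisms_Aut:
  assumes "g \<in> standard_automorphisms"
  shows "g \<in> carrier (Aut spectral_ball)" "inv\<^bsub>Aut spectral_ball\<^esub> g \<in> standard_automorphisms"
    "affine_on_classes g"
proof -
  consider "g = restrict transpose spectral_ball"
    | \<alpha> \<gamma> where "g = restrict (moebius \<alpha> \<gamma>) spectral_ball" "norm \<alpha> < 1" "norm \<gamma> = 1"
    | u where "g = restrict (conjugation u) spectral_ball" "conj_invariant_holomorphic u"
    using assms unfolding standard_automorphisms_def by blast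
  then have "g \<in> carrier (Aut spectral_ball) \<and> inv\<^bsub>Aut spectral_ball\<^esub> g \<in> standard_automorphisms
    \<and> affine_on_classes g"
  proof cases
    case 1
    then show ?thesis
      using transpose_Aut affine_on_classes_transpose by (simp add: standard_automorphisms_def)
  next
    case 2
    then have "norm (- \<gamma> * \<alpha>) < 1" "norm (cnj \<gamma>) = 1"
      by (simp_all add: norm_mult)
    then have "restrict (moebius (- \<gamma> * \<alpha>) (cnj \<gamma>)) spectral_ball \<in> standard_automorphisms"
      unfolding standard_automorphisms_def by blast
    with 2 show ?thesis
      using moebius_Aut[OF 2(2,3)] affine_on_classes_moebius by simp
  next
    case 3
    then have "restrict (conjugation (\<lambda>x. matrix_inv (u x))) spectral_ball \<in> standard_automorphisms"
      using conj_invariant_holomorphic_matrix_inv[of u] unfolding standard_automorphisms_def by blast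
    with 3 show ?thesis
      using conjugation_Aut[OF 3(2)] affine_on_classes_conjugation by simp
  qed
  then show "g \<in> carrier (Aut spectral_ball)" "inv\<^bsub>Aut spectral_ball\<^esub> g \<in> standard_automorphisms"
    "affine_on_classes g"
    by blast+
qed

text \<open>Membership in the automorphism group is carried through the induction, since composing
  affine maps requires the inner one to preserve the ball.\<close>

lemma generate_standard_affine:
  assumes "g \<in> generate (Aut spectral_ball) standard_automorphisms"
  shows "affine_on_classes g"
proof -
  have "g \<in> carrier (Aut spectral_ball) \<and> affine_on_classes g"
    using assms
  proof induction
    case one
    have "affine_on_classes (\<lambda>x\<in>spectral_ball. x)"
      by (rule affine_on_classes_restrict[where A = "\<lambda>x z. z" and B = "\<lambda>x. 0"])
        (auto intro: similar_refl simp: linear_iff)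
    then have "affine_on_classes \<one>\<^bsub>Aut spectral_ball\<^esub>"
      by (simp add: Aut_def BijGroup_def)
    then show ?case
      using monoid.one_closed[OF group.is_monoid[OF group_Aut]] by blast
  next
    case (incl h)
    then show ?case by (simp add: standard_automorphisms_Aut)
  next
    case (inv h)
    then show ?case by (simp add: standard_automorphisms_Aut)
  next
    case (eng h1 h2)
    then have Bij: "h1 \<in> Bij spectral_ball" "h2 \<in> Bij spectral_ball"
      by (auto simp: Aut_def biholo_def)
    then have "h1 \<otimes>\<^bsub>Aut spectral_ball\<^esub> h2 = compose spectral_ball h1 h2"
      by (simp add: Aut_def BijGroup_def)
    moreover have "affine_on_classes (compose spectral_ball h1 h2)"
      using eng Bij_imp_funcset[OF Bij(2)] by (intro affine_on_classes_compose) auto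
    moreover have "h1 \<otimes>\<^bsub>Aut spectral_ball\<^esub> h2 \<in> carrier (Aut spectral_ball)"
      by (rule monoid.m_closed[OF group.is_monoid[OF group_Aut]]) (use eng in auto)
    ultimately show ?case by simp
  qed
  then show ?thesis ..
qed

text \<open>For real-linear \<open>A\<close>, averaging over \<open>X a b c\<close> and \<open>X (- a) b c\<close> removes the diagonal part.\<close>

lemma affine_twist_imp_constant:
  assumes holo: "\<phi> holomorphic_on UNIV"
    and aff: "affine_on_classes (restrict (twist \<phi>) spectral_ball)"
  shows "\<phi> constant_on UNIV"
proof -
  \<comment> \<open>Traceless matrices: the square of \<open>X a b c\<close> is a^2 + bc times the
    identity. The base point \<open>?x\<close> has eigenvalues 1/2 and -1/2, so its class is given
    by a^2 + bc = 1/4.\<close>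
  define X :: "complex \<Rightarrow> complex \<Rightarrow> complex \<Rightarrow> cmat2"
    where "X a b c = vector [vector [a, b], vector [c, - a]]" for a b c
  have X_nth: "X a b c $ 1 $ 1 = a" "X a b c $ 1 $ 2 = b" "X a b c $ 2 $ 1 = c" "X a b c $ 2 $ 2 = - a"
    for a b c by (simp_all add: X_def)
  let ?x = "X 0 1 (1/4)"
  have x: "?x \<in> spectral_ball"
    unfolding spectral_ball_iff
  proof (intro allI impI)
    fix k assume "k\<^sup>2 - trace ?x * k + det ?x = 0"
    then have "k\<^sup>2 = (1/2)\<^sup>2"
      by (simp add: trace_2 det_2 X_nth power2_eq_square)
    then have "k = 1/2 \<or> k = - (1/2)" by (simp only: power2_eq_iff)
    then show "norm k < 1" by (elim disjE; hypsubst; simp add: norm_divide)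
  qed
  obtain A B where A: "linear A" and
    eq: "\<And>z. similar ?x z \<Longrightarrow> restrict (twist \<phi>) spectral_ball z = A z + B"
    using aff[unfolded affine_on_classes_def, rule_format, OF x] by blast
  define K where "K z = A z $ 1 $ 2" for z
  have K_add: "K (y + z) = K y + K z" for y z
    by (simp add: K_def linear_add[OF A])
  have K_X: "K (X a b c) + K (X (- a) b c) = 2 * (K (X 0 b 0) + K (X 0 0 c))" for a b c
  proof -
    have "X a b c + X (- a) b c = (X 0 b 0 + X 0 0 c) + (X 0 b 0 + X 0 0 c)"
      by (simp add: mat2_eq_iff X_nth)
    then show ?thesis by (metis K_add mult_2)
  qed
  have val: "exp (- \<phi> (b * c)) * b = K (X a b c) + B $ 1 $ 2" if "similar ?x (X a b c)" for a b c
  proof -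
    have "X a b c \<in> spectral_ball" using similar_spectral_ball[OF that x] .
    then show ?thesis
      using arg_cong[OF eq[OF that], of "\<lambda>z. z $ 1 $ 2"] by (simp add: K_def twist_def X_nth)
  qed
  \<comment> \<open>Such a matrix z satisfies z^2 = 1/4, so for any row vector r the matrix q with
    rows r and rz satisfies qz = \<open>?x\<close> q. Here r = (1, 0).\<close>
  have sim1: "similar ?x (X a 1 c)" if "a\<^sup>2 + c = 1/4" for a c
  proof (rule similarI)
    let ?q = "vector [vector [1, 0], vector [a, 1]] :: cmat2"
    show "invertible ?q" by (simp add: invertible_det_nz det_2)
    show "?q ** X a 1 c = ?x ** ?q"
      using that by (simp add: mat2_eq_iff matrix_mult_2 X_nth power2_eq_square)
  qed
  have sim0: "similar ?x (X a 0 c)" if a: "a\<^sup>2 = 1/4" for a c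
  proof (rule similarI)
    \<comment> \<open>The same construction with r = (y, 1); the value of \<open>y\<close> makes the
      determinant of \<open>?q\<close> equal to 1.\<close>
    define y where "y = - (1 + c) / (2 * a)"
    let ?q = "vector [vector [y, 1], vector [y * a + c, - a]] :: cmat2"
    have "a \<noteq> 0" using a by auto
    then have "2 * (a * y) = - (1 + c)" by (simp add: y_def)
    then have "det ?q = 1" by (simp add: det_2)
    then show "invertible ?q" by (simp add: invertible_det_nz)
    have aa: "a * a = 1 / 4"
      using a by (simp only: power2_eq_square)
    have "y * a * a = y / 4"
      by (simp only: mult.assoc aa) simp
    with aa show "?q ** X a 0 c = ?x ** ?q"
      by (simp add: mat2_eq_iff matrix_mult_2 X_nth distrib_right)
  qed
  \<comment> \<open>For b = 0 the twisted entry is 0, and averaging over a = 1/2 and a = -1/2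
    isolates the contribution of \<open>c\<close>.\<close>
  have zero: "K (X 0 0 c) + B $ 1 $ 2 = 0" for c
  proof -
    have "(1/2)\<^sup>2 = (1/4 :: complex)" "(- (1/2))\<^sup>2 = (1/4 :: complex)"
      by (simp_all add: power2_eq_square)
    from val[OF sim0[OF this(1)], of c] val[OF sim0[OF this(2)], of c]
    have "K (X (1/2) 0 c) + B $ 1 $ 2 = 0" "K (X (- (1/2)) 0 c) + B $ 1 $ 2 = 0"
      by (simp_all only: mult_zero_right)
    then have "2 * (K (X 0 0 0) + (K (X 0 0 c) + B $ 1 $ 2)) = 0"
      using K_X[of "1/2" 0 c] by algebra
    moreover have "X 0 0 0 + X 0 0 0 = X 0 0 0"
      by (simp add: mat2_eq_iff X_nth)
    then have "K (X 0 0 0) = 0"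
      using K_add[of "X 0 0 0" "X 0 0 0"] by simp
    ultimately show ?thesis by (simp del: distrib_left_numeral)
  qed
  \<comment> \<open>For b = 1 the product of the off-diagonal entries is \<open>c\<close> itself,
    and a square root \<open>a\<close> exists for every \<open>c\<close>. Averaging over both roots
    removes \<open>a\<close>, and \<open>zero\<close> removes the remaining dependence on
    \<open>c\<close>.\<close>
  have const: "exp (- \<phi> c) = K (X 0 1 0)" for c
  proof -
    define a where "a = csqrt (1/4 - c)"
    then have "a\<^sup>2 + c = 1/4" "(- a)\<^sup>2 + c = 1/4" by simp_all
    from val[OF sim1[OF this(1)]] val[OF sim1[OF this(2)]]
    have "exp (- \<phi> c) = K (X a 1 c) + B $ 1 $ 2" "exp (- \<phi> c) = K (X (- a) 1 c) + B $ 1 $ 2"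
      by (simp_all only: mult_1_left mult_1_right)
    then have "2 * exp (- \<phi> c) = 2 * (K (X 0 1 0) + (K (X 0 0 c) + B $ 1 $ 2))"
      using K_X[of a 1 c] by algebra
    then show ?thesis by (simp del: distrib_left_numeral add: zero)
  qed
  \<comment> \<open>Constancy of exp(-\<phi>) fixes \<phi> only modulo 2 pi i at each point.
    Differentiating and cancelling the nonzero exponential gives constancy of \<phi> itself.\<close>
  have "(\<phi> has_field_derivative 0) (at z)" for z
  proof -
    have d: "(\<phi> has_field_derivative deriv \<phi> z) (at z)"
      using holo holomorphic_derivI by blast
    then have "((\<lambda>z. exp (- \<phi> z)) has_field_derivative exp (- \<phi> z) * - deriv \<phi> z) (at z)"
      by (auto intro!: derivative_eq_intros)
    moreover have "((\<lambda>z. exp (- \<phi> z)) has_field_derivative 0) (at z)"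
      by (simp add: const)
    ultimately have "exp (- \<phi> z) * - deriv \<phi> z = 0"
      by (rule DERIV_unique)
    with d show ?thesis by simp
  qed
  then have "\<exists>c. \<forall>z\<in>UNIV. \<phi> z = c"
    by (intro has_field_derivative_zero_constant) auto
  then show ?thesis by (auto simp: constant_on_def)
qed

theorem theorem1:
  fixes \<phi> :: "complex \<Rightarrow> complex"
  assumes "\<phi> holomorphic_on UNIV"
  shows "restrict (twist \<phi>) spectral_ball \<in> carrier (Aut spectral_ball) \<and>
    (\<not> \<phi> constant_on UNIV \<longrightarrow>
      restrict (twist \<phi>) spectral_ball \<notin> generate (Aut spectral_ball) standard_automorphisms)"
proof (intro conjI impI notI)
  assume "\<not> \<phi> constant_on UNIV"
    and "restrict (twist \<phi>) spectral_ball \<in> generate (Aut spectral_ball) standard_automorphisms"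
  then show False
    using affine_twist_imp_constant[OF assms generate_standard_affine] by simp
qed (rule twist_Aut[OF assms])

end
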